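(* Let $(S,\mathcal{A},\mu)$ be a complete, $\sigma$-finite measure space and $X$ a real Banach space with property $( ** )$. Then $L^1(\mu,X)$ and $L^\infty(\mu,X)$ also have property $( ** )$.
   Context: For a real Banach space $X$, $y^*\in S_{X^*}$ and $\varepsilon>0$, $S(y^*,\varepsilon)=\{z\in B_X:y^*(z)>1-\varepsilon\}$, and $d(x,A)=\inf_{a\in A}\|x-a\|$. $X$ has property $( ** )$ if for all $x_1,x_2\in S_X$ and each $\varepsilon>0$ there is $y^*\in S_{X^*}$ with $x_1\in S(y^*,\varepsilon)$ and $d(x_2,S(y^*,\varepsilon))+d(x_2,-S(y^*,\varepsilon))<2+\varepsilon$. $L^1(\mu,X)$, $L^\infty(\mu,X)$ are the Lebesgue–Bochner spaces. *)

theory Defs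
  imports "HOL-Analysis.Analysis"
begin

text \<open>A (semi)normed real vector space is presented by a carrier V, explicit addition,
  scalar multiplication and a seminorm N.  Working with a seminorm on the space of
  functions is equivalent to working on the quotient by null functions.\<close>

definition dual_sphere ::
  "'v set \<Rightarrow> ('v \<Rightarrow> 'v \<Rightarrow> 'v) \<Rightarrow> (real \<Rightarrow> 'v \<Rightarrow> 'v) \<Rightarrow> ('v \<Rightarrow> real) \<Rightarrow> ('v \<Rightarrow> real) set" where
  "dual_sphere V add scal N = {y.
      (\<forall>u\<in>V. \<forall>v\<in>V. y (add u v) = y u + y v) \<and>
      (\<forall>c. \<forall>u\<in>V. y (scal c u) = c * y u) \<and>
      (\<exists>C. \<forall>z\<in>V. \<bar>y z\<bar> \<le> C * N z) \<and>
      Sup {\<bar>y z\<bar> | z. z \<in> V \<and> N z \<le> 1} = 1}"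

definition slice :: "'v set \<Rightarrow> ('v \<Rightarrow> real) \<Rightarrow> ('v \<Rightarrow> real) \<Rightarrow> real \<Rightarrow> 'v set" where
  "slice V N y \<epsilon> = {z \<in> V. N z \<le> 1 \<and> y z > 1 - \<epsilon>}"

definition sdist ::
  "('v \<Rightarrow> 'v \<Rightarrow> 'v) \<Rightarrow> (real \<Rightarrow> 'v \<Rightarrow> 'v) \<Rightarrow> ('v \<Rightarrow> real) \<Rightarrow> 'v \<Rightarrow> 'v set \<Rightarrow> real" where
  "sdist add scal N x A = Inf {N (add x (scal (-1) a)) | a. a \<in> A}"

definition property_star_star ::
  "'v set \<Rightarrow> ('v \<Rightarrow> 'v \<Rightarrow> 'v) \<Rightarrow> (real \<Rightarrow> 'v \<Rightarrow> 'v) \<Rightarrow> ('v \<Rightarrow> real) \<Rightarrow> bool" where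
  "property_star_star V add scal N \<longleftrightarrow>
    (\<forall>x1\<in>V. \<forall>x2\<in>V. N x1 = 1 \<longrightarrow> N x2 = 1 \<longrightarrow> (\<forall>\<epsilon>>0.
      (\<exists>y\<in>dual_sphere V add scal N. x1 \<in> slice V N y \<epsilon> \<and>
         sdist add scal N x2 (slice V N y \<epsilon>)
         + sdist add scal N x2 (scal (-1) ` slice V N y \<epsilon>) < 2 + \<epsilon>)))"

text \<open>Property (**) of a real Banach space (type).\<close>
abbreviation banach_property_star_star :: "'b::banach itself \<Rightarrow> bool" where
  "banach_property_star_star _ \<equiv> property_star_star (UNIV :: 'b set) (+) (*\<^sub>R) norm"

text \<open>Strong (Bochner) measurability: a.e. limit of a sequence of simple functions.\<close>
definition strongly_measurable :: "'a measure \<Rightarrow> ('a \<Rightarrow> 'b::real_normed_vector) \<Rightarrow> bool" where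
  "strongly_measurable M f \<longleftrightarrow>
    (\<exists>s :: nat \<Rightarrow> 'a \<Rightarrow> 'b. (\<forall>n. simple_function M (s n)) \<and>
       (AE x in M. (\<lambda>n. s n x) \<longlonglongrightarrow> f x))"

definition fun_add :: "('a \<Rightarrow> 'b::real_vector) \<Rightarrow> ('a \<Rightarrow> 'b) \<Rightarrow> 'a \<Rightarrow> 'b" where
  "fun_add f g = (\<lambda>x. f x + g x)"

definition fun_scal :: "real \<Rightarrow> ('a \<Rightarrow> 'b::real_vector) \<Rightarrow> 'a \<Rightarrow> 'b" where
  "fun_scal c f = (\<lambda>x. c *\<^sub>R f x)"

text \<open>Lebesgue--Bochner space L^1(M,X) (carrier and seminorm).\<close>
definition L1_set :: "'a measure \<Rightarrow> ('a \<Rightarrow> 'b::real_normed_vector) set" where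
  "L1_set M = {f. strongly_measurable M f \<and> (\<integral>\<^sup>+ x. ennreal (norm (f x)) \<partial>M) < \<infinity>}"

definition L1_norm :: "'a measure \<Rightarrow> ('a \<Rightarrow> 'b::real_normed_vector) \<Rightarrow> real" where
  "L1_norm M f = enn2real (\<integral>\<^sup>+ x. ennreal (norm (f x)) \<partial>M)"

text \<open>Lebesgue--Bochner space L^infinity(M,X) (carrier and seminorm = essential sup of the norm).\<close>
definition Linf_set :: "'a measure \<Rightarrow> ('a \<Rightarrow> 'b::real_normed_vector) set" where
  "Linf_set M = {f. strongly_measurable M f \<and> (\<exists>C. AE x in M. norm (f x) \<le> C)}"

definition Linf_norm :: "'a measure \<Rightarrow> ('a \<Rightarrow> 'b::real_normed_vector) \<Rightarrow> real" where
  "Linf_norm M f = Inf {C. 0 \<le> C \<and> (AE x in M. norm (f x) \<le> C)}"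

end

theory Submission
  imports Defs
begin

text \<open>For L^1, approximate x1 and x2 by simple functions of norm one; at each of their finitely
  many joint values apply (**) in X, scaled by the norm of the value of the approximant of x2, and
  integrate the resulting functionals and slice points.  For L^infinity, sigma-finiteness and the
  separable valuedness of strongly measurable functions give a set A of positive finite measure on
  which x1 is nearly a constant of norm nearly one and x2 is nearly a constant; apply (**) in X to
  the two constants, average the functional over A, and let the slice points equal the witnesses on
  A and x2, resp. -x2, off A.  In both cases a functional of norm at most one suffices, since it can
  be normalized afterwards.\<close>

section \<open>Strongly measurable functions\<close>

lemma (in complete_measure) measurable_AE_eq:
  assumes f: "f \<in> M \<rightarrow>\<^sub>M N" and ae: "AE x in M. f x = g x"
    and g: "\<And>x. x \<in> space M \<Longrightarrow> g x \<in> space N"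
  shows "g \<in> M \<rightarrow>\<^sub>M N"
proof (rule measurableI)
  fix A assume "A \<in> sets N"
  then have "f -` A \<inter> space M \<in> sets M" using f by (rule measurable_sets[rotated])
  moreover have "AE x in M. x \<in> f -` A \<inter> space M \<longleftrightarrow> x \<in> g -` A \<inter> space M"
    using ae AE_space by eventually_elim auto
  ultimately show "g -` A \<inter> space M \<in> sets M" using in_sets_AE by blast
qed (use g in auto)

lemma borel_measurable_AE_LIMSEQ:
  fixes g :: "'a \<Rightarrow> 'c::metric_space"
  assumes "complete_measure M" and u: "\<And>n. u n \<in> borel_measurable M"
    and lim: "AE x in M. (\<lambda>n. u n x) \<longlonglongrightarrow> g x"
  shows "g \<in> borel_measurable M"
proof -
  obtain N where N: "N \<in> sets M" "emeasure M N = 0" "{x\<in>space M. \<not> (\<lambda>n. u n x) \<longlonglongrightarrow> g x} \<subseteq> N"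
    using lim by (auto elim!: AE_E)
  define g' where "g' x = (if x \<in> N then undefined else g x)" for x
  have "g' \<in> borel_measurable M"
  proof (rule borel_measurable_LIMSEQ_metric)
    show "(\<lambda>x. if x \<in> N then undefined else u n x) \<in> borel_measurable M" for n
      using u N(1) by (intro measurable_If_set) auto
    show "(\<lambda>n. if x \<in> N then undefined else u n x) \<longlonglongrightarrow> g' x" if "x \<in> space M" for x
      using that N(3) by (auto simp: g'_def)
  qed
  moreover have "AE x in M. g' x = g x"
    by (rule AE_I'[of N]) (use N in \<open>auto simp: g'_def null_sets_def\<close>)
  ultimately show ?thesis
    by (rule complete_measure.measurable_AE_eq[OF assms(1)]) simp
qed

lemma strongly_measurable_simple: "simple_function M f \<Longrightarrow> strongly_measurable M f"
  unfolding strongly_measurable_def by (rule exI[of _ "\<lambda>n. f"]) auto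

lemma strongly_measurable_add:
  assumes "strongly_measurable M f" "strongly_measurable M g"
  shows "strongly_measurable M (\<lambda>x. f x + g x)"
proof -
  obtain s where s: "\<And>n. simple_function M (s n)" "AE x in M. (\<lambda>n. s n x) \<longlonglongrightarrow> f x"
    using assms(1) unfolding strongly_measurable_def by blast
  obtain r where r: "\<And>n. simple_function M (r n)" "AE x in M. (\<lambda>n. r n x) \<longlonglongrightarrow> g x"
    using assms(2) unfolding strongly_measurable_def by blast
  show ?thesis unfolding strongly_measurable_def
    using s r by (intro exI[of _ "\<lambda>n x. s n x + r n x"])
      (auto intro: simple_function_compose2 tendsto_add elim!: AE_mp)
qed

lemma strongly_measurable_scaleR:
  assumes "strongly_measurable M f"
  shows "strongly_measurable M (\<lambda>x. c *\<^sub>R f x)"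
proof -
  obtain s where s: "\<And>n. simple_function M (s n)" "AE x in M. (\<lambda>n. s n x) \<longlonglongrightarrow> f x"
    using assms unfolding strongly_measurable_def by blast
  show ?thesis unfolding strongly_measurable_def
    using s by (intro exI[of _ "\<lambda>n x. c *\<^sub>R s n x"])
      (auto intro: simple_function_compose1 tendsto_scaleR elim!: AE_mp[OF _ AE_I2])
qed

lemma strongly_measurable_diff:
  "strongly_measurable M f \<Longrightarrow> strongly_measurable M g \<Longrightarrow> strongly_measurable M (\<lambda>x. f x - g x)"
  using strongly_measurable_add[of M f "\<lambda>x. (-1) *\<^sub>R g x"] strongly_measurable_scaleR[of M g "-1"]
  by simp

lemma strongly_measurable_If:
  assumes "strongly_measurable M f" "strongly_measurable M g" "A \<in> sets M"
  shows "strongly_measurable M (\<lambda>x. if x \<in> A then f x else g x)"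
proof -
  obtain s where s: "\<And>n. simple_function M (s n)" "AE x in M. (\<lambda>n. s n x) \<longlonglongrightarrow> f x"
    using assms(1) unfolding strongly_measurable_def by blast
  obtain r where r: "\<And>n. simple_function M (r n)" "AE x in M. (\<lambda>n. r n x) \<longlonglongrightarrow> g x"
    using assms(2) unfolding strongly_measurable_def by blast
  have "simple_function M (\<lambda>x. if x \<in> A then s n x else r n x)" for n
    using assms(3) by (intro simple_function_If_set s(1) r(1)) auto
  moreover have "AE x in M. (\<lambda>n. if x \<in> A then s n x else r n x) \<longlonglongrightarrow> (if x \<in> A then f x else g x)"
    using s(2) r(2) by eventually_elim auto
  ultimately show ?thesis unfolding strongly_measurable_def
    by (intro exI[of _ "\<lambda>n x. if x \<in> A then s n x else r n x"]) blast
qed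

lemma borel_measurable_continuous_comp_strongly_measurable:
  fixes \<phi> :: "'b::real_normed_vector \<Rightarrow> 'c::metric_space"
  assumes "complete_measure M" "strongly_measurable M f" "continuous_on UNIV \<phi>"
  shows "(\<lambda>x. \<phi> (f x)) \<in> borel_measurable M"
proof -
  obtain s where s: "\<And>n. simple_function M (s n)" "AE x in M. (\<lambda>n. s n x) \<longlonglongrightarrow> f x"
    using assms(2) unfolding strongly_measurable_def by blast
  show ?thesis
  proof (rule borel_measurable_AE_LIMSEQ[OF assms(1)])
    show "(\<lambda>x. \<phi> (s n x)) \<in> borel_measurable M" for n
      by (rule borel_measurable_simple_function) (rule simple_function_compose1[OF s(1)])
    show "AE x in M. (\<lambda>n. \<phi> (s n x)) \<longlonglongrightarrow> \<phi> (f x)"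
      using s(2) by eventually_elim
        (metis assms(3) continuous_on_tendsto_compose UNIV_I eventually_sequentially)
  qed
qed

lemma borel_measurable_norm_strongly_measurable:
  "complete_measure M \<Longrightarrow> strongly_measurable M f \<Longrightarrow> (\<lambda>x. norm (f x)) \<in> borel_measurable M"
  by (rule borel_measurable_continuous_comp_strongly_measurable) (auto intro: continuous_on_norm_id)

lemma borel_measurable_simple_parametric:
  fixes F :: "'c \<Rightarrow> 'a \<Rightarrow> real"
  assumes p: "simple_function M p" and F: "\<And>v. F v \<in> borel_measurable M"
  shows "(\<lambda>x. F (p x) x) \<in> borel_measurable M"
proof -
  have "F (p x) x = (\<Sum>v\<in>p ` space M. indicator (p -` {v} \<inter> space M) x * F v x)" if "x \<in> space M" for x
  proof -
    have "(\<Sum>v\<in>p ` space M. indicator (p -` {v} \<inter> space M) x * F v x) =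
          (\<Sum>v\<in>p ` space M. if v = p x then F v x else 0)"
      using that by (intro sum.cong) (auto simp: indicator_def)
    also have "\<dots> = F (p x) x"
      using p that by (simp add: simple_function_def sum.delta')
    finally show ?thesis by simp
  qed
  moreover have "(\<lambda>x. \<Sum>v\<in>p ` space M. indicator (p -` {v} \<inter> space M) x * F v x) \<in> borel_measurable M"
    using simple_functionD(2)[OF p] F
    by (intro borel_measurable_sum borel_measurable_times borel_measurable_indicator) auto
  ultimately show ?thesis by (subst measurable_cong) auto
qed

section \<open>Functionals of norm at most one and property (**) in X\<close>

lemma scaleR_norm_sgn: "norm x *\<^sub>R sgn x = (x :: 'b::real_normed_vector)"
  by (cases "x = 0") (simp_all add: sgn_div_norm)

definition dual_unit_ball :: "('b::real_normed_vector \<Rightarrow> real) set" where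
  "dual_unit_ball = {Y. linear Y \<and> (\<forall>x. \<bar>Y x\<bar> \<le> norm x)}"

lemma dual_unit_ballD:
  assumes "Y \<in> dual_unit_ball"
  shows "Y (u + v) = Y u + Y v" "Y (c *\<^sub>R u) = c * Y u" "\<bar>Y u\<bar> \<le> norm u"
  using assms linear_add[of Y] linear_scale[of Y] by (auto simp: dual_unit_ball_def)

lemma dual_unit_ball_ge: "Y \<in> dual_unit_ball \<Longrightarrow> Y a - norm (u - a) \<le> Y u"
  using dual_unit_ballD(1)[of Y a "u - a"] dual_unit_ballD(3)[of Y "u - a"] by simp

lemma dual_unit_ball_continuous: "Y \<in> dual_unit_ball \<Longrightarrow> continuous_on UNIV Y"
  by (intro linear_continuous_on bounded_linear_intro[where K = 1]) (auto dest: dual_unit_ballD)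

lemma dual_sphere_subset_dual_unit_ball:
  "dual_sphere UNIV (+) (*\<^sub>R) norm \<subseteq> (dual_unit_ball :: ('b::real_normed_vector \<Rightarrow> real) set)"
proof
  fix Y :: "'b \<Rightarrow> real" assume Y: "Y \<in> dual_sphere UNIV (+) (*\<^sub>R) norm"
  then have lin: "linear Y"
    by (intro linearI) (auto simp: dual_sphere_def)
  obtain C where C: "\<And>z. \<bar>Y z\<bar> \<le> C * norm z" using Y by (auto simp: dual_sphere_def)
  have bdd: "bdd_above {\<bar>Y z\<bar> | z. z \<in> UNIV \<and> norm z \<le> 1}"
    using C by (intro bdd_aboveI[of _ "\<bar>C\<bar>"], auto)
      (smt (verit, ccfv_SIG) abs_ge_self mult_left_le norm_ge_zero mult_right_mono)
  have unit: "\<bar>Y z\<bar> \<le> 1" if "norm z \<le> 1" for z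
    using cSup_upper[OF _ bdd, of "\<bar>Y z\<bar>"] that Y by (auto simp: dual_sphere_def)
  have "\<bar>Y x\<bar> \<le> norm x" for x
  proof -
    have "\<bar>Y x\<bar> = norm x * \<bar>Y (sgn x)\<bar>"
      using linear_scale[OF lin, of "norm x" "sgn x"]
      by (cases "x = 0") (simp_all add: scaleR_norm_sgn linear_0[OF lin] abs_mult)
    also have "\<dots> \<le> norm x" using unit[of "sgn x"] by (simp add: norm_sgn mult_left_le)
    finally show ?thesis .
  qed
  then show "Y \<in> dual_unit_ball" using lin by (simp add: dual_unit_ball_def)
qed

lemma sdist_lessD:
  assumes "sdist add scal N x A < r" "A \<noteq> {}"
  obtains a where "a \<in> A" "N (add x (scal (-1) a)) < r"
  using cInf_lessD[of "{N (add x (scal (-1) a)) | a. a \<in> A}" r] assms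
  unfolding sdist_def by blast

lemma star_star_witness:
  fixes e1 e2 :: "'b::banach"
  assumes "banach_property_star_star TYPE('b)" "norm e1 = 1" "norm e2 = 1" "\<delta> > 0"
  obtains Y z w where "Y \<in> dual_unit_ball" "1 - \<delta> < Y e1" "norm z \<le> 1" "norm w \<le> 1"
    "1 - \<delta> < Y z" "1 - \<delta> < Y w" "norm (e2 - z) + norm (e2 + w) < 2 + \<delta>"
proof -
  obtain Y where Y: "Y \<in> dual_sphere UNIV (+) (*\<^sub>R) norm" and e1: "e1 \<in> slice UNIV norm Y \<delta>"
    and sum: "sdist (+) (*\<^sub>R) norm e2 (slice UNIV norm Y \<delta>)
         + sdist (+) (*\<^sub>R) norm e2 ((*\<^sub>R) (-1) ` slice UNIV norm Y \<delta>) < 2 + \<delta>"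
    using assms unfolding property_star_star_def by blast
  define S where "S = slice UNIV norm Y \<delta>"
  define d1 where "d1 = sdist (+) (*\<^sub>R) norm e2 S"
  define d2 where "d2 = sdist (+) (*\<^sub>R) norm e2 ((*\<^sub>R) (-1) ` S)"
  define e where "e = (2 + \<delta> - d1 - d2) / 2"
  have "0 < e" using sum by (simp add: e_def d1_def d2_def S_def)
  have "d1 + d2 + 2 * e = 2 + \<delta>" by (simp add: e_def field_simps)
  have "S \<noteq> {}" using e1 by (auto simp: S_def)
  obtain z where z: "z \<in> S" "norm (e2 - z) < d1 + e"
    by (rule sdist_lessD[of "(+)" "(*\<^sub>R)" norm e2 S "d1 + e"])
      (use \<open>0 < e\<close> \<open>S \<noteq> {}\<close> in \<open>auto simp: d1_def\<close>)
  obtain w' where w': "w' \<in> (*\<^sub>R) (-1) ` S" "norm (e2 + (-1) *\<^sub>R w') < d2 + e"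
    by (rule sdist_lessD[of "(+)" "(*\<^sub>R)" norm e2 "(*\<^sub>R) (-1) ` S" "d2 + e"])
      (use \<open>0 < e\<close> \<open>S \<noteq> {}\<close> in \<open>auto simp: d2_def\<close>)
  then obtain w where w: "w \<in> S" "norm (e2 + w) < d2 + e"
    by auto
  show thesis
  proof
    show "Y \<in> dual_unit_ball" using Y dual_sphere_subset_dual_unit_ball by blast
    show "norm (e2 - z) + norm (e2 + w) < 2 + \<delta>"
      using z(2) w(2) \<open>d1 + d2 + 2 * e = 2 + \<delta>\<close> by linarith
  qed (use e1 z(1) w(1) in \<open>auto simp: S_def slice_def\<close>)
qed

lemma choice3: "\<forall>x. \<exists>a b c. P x a b c \<Longrightarrow> \<exists>f g h. \<forall>x. P x (f x) (g x) (h x)"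
proof -
  assume "\<forall>x. \<exists>a b c. P x a b c"
  then have "\<forall>x. \<exists>q. P x (fst q) (fst (snd q)) (snd (snd q))" by simp
  from choice[OF this] obtain F where "\<forall>x. P x (fst (F x)) (fst (snd (F x))) (snd (snd (F x)))"
    by blast
  then show ?thesis
    by (intro exI[of _ "\<lambda>x. fst (F x)"] exI[of _ "\<lambda>x. fst (snd (F x))"] exI[of _ "\<lambda>x. snd (snd (F x))"])
qed

text \<open>The nontriviality of 'b is needed only when a = b = 0.\<close>
lemma star_star_scaled_witness:
  fixes a b :: "'b::banach"
  assumes "banach_property_star_star TYPE('b)" "(UNIV :: 'b set) \<noteq> {0}" "\<delta> > 0"
  obtains Y z w where "Y \<in> dual_unit_ball" "(1 - \<delta>) * norm a \<le> Y a" "norm z \<le> 1" "norm w \<le> 1"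
    "1 - \<delta> < Y z" "1 - \<delta> < Y w"
    "norm (b - norm b *\<^sub>R z) + norm (b + norm b *\<^sub>R w) \<le> (2 + \<delta>) * norm b"
proof -
  obtain e :: 'b where "e \<noteq> 0" using assms(2) by auto
  define e1 where "e1 = (if a \<noteq> 0 then sgn a else if b \<noteq> 0 then sgn b else sgn e)"
  define e2 where "e2 = (if b \<noteq> 0 then sgn b else e1)"
  have "norm e1 = 1" "norm e2 = 1" using \<open>e \<noteq> 0\<close> by (auto simp: e1_def e2_def norm_sgn)
  then obtain Y z w where Y: "Y \<in> dual_unit_ball" "1 - \<delta> < Y e1" "norm z \<le> 1" "norm w \<le> 1"
    "1 - \<delta> < Y z" "1 - \<delta> < Y w" "norm (e2 - z) + norm (e2 + w) < 2 + \<delta>"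
    using star_star_witness[OF assms(1) _ _ assms(3)] by blast
  have "(1 - \<delta>) * norm a \<le> Y a"
  proof (cases "a = 0")
    case False
    then have "Y a = norm a * Y e1"
      using dual_unit_ballD(2)[OF Y(1), of "norm a" "sgn a"] by (simp add: e1_def scaleR_norm_sgn)
    then show ?thesis using Y(2) by (simp add: mult.commute mult_left_mono)
  qed (use dual_unit_ballD(3)[OF Y(1), of 0] in simp)
  moreover have "norm (b - norm b *\<^sub>R z) + norm (b + norm b *\<^sub>R w) \<le> (2 + \<delta>) * norm b"
  proof (cases "b = 0")
    case False
    have "b - norm b *\<^sub>R z = norm b *\<^sub>R (e2 - z)" "b + norm b *\<^sub>R w = norm b *\<^sub>R (e2 + w)"
      using False by (simp_all add: e2_def scaleR_norm_sgn algebra_simps)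
    then have "norm (b - norm b *\<^sub>R z) + norm (b + norm b *\<^sub>R w) = norm b * (norm (e2 - z) + norm (e2 + w))"
      by (simp add: distrib_left)
    also have "\<dots> \<le> norm b * (2 + \<delta>)" using Y(7) by (intro mult_left_mono) auto
    finally show ?thesis by (simp add: mult.commute)
  qed simp
  ultimately show thesis using Y that by blast
qed

lemma star_star_scaled_witness_family:
  fixes \<delta> :: real
  assumes "banach_property_star_star TYPE('b)" "(UNIV :: 'b set) \<noteq> {0}" "\<delta> > 0"
  obtains Y :: "'b::banach \<Rightarrow> 'b \<Rightarrow> 'b \<Rightarrow> real" and z w where "\<And>a b. Y a b \<in> dual_unit_ball"
    "\<And>a b. (1 - \<delta>) * norm a \<le> Y a b a" "\<And>a b. norm (z a b) \<le> 1" "\<And>a b. norm (w a b) \<le> 1"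
    "\<And>a b. 1 - \<delta> < Y a b (z a b)" "\<And>a b. 1 - \<delta> < Y a b (w a b)"
    "\<And>a b. norm (b - norm b *\<^sub>R z a b) + norm (b + norm b *\<^sub>R w a b) \<le> (2 + \<delta>) * norm b"
proof -
  have "\<forall>q :: 'b \<times> 'b. \<exists>Y z w. Y \<in> dual_unit_ball \<and> (1 - \<delta>) * norm (fst q) \<le> Y (fst q) \<and>
      norm z \<le> 1 \<and> norm w \<le> 1 \<and> 1 - \<delta> < Y z \<and> 1 - \<delta> < Y w \<and>
      norm (snd q - norm (snd q) *\<^sub>R z) + norm (snd q + norm (snd q) *\<^sub>R w) \<le> (2 + \<delta>) * norm (snd q)"
    (is "\<forall>q. \<exists>Y z w. ?witness q Y z w")
  proof
    fix q :: "'b \<times> 'b"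
    obtain Y z w where "?witness q Y z w"
      using star_star_scaled_witness[OF assms, of "fst q" "snd q"] by blast
    then show "\<exists>Y z w. ?witness q Y z w" by blast
  qed
  from choice3[OF this] obtain Y z w where "\<forall>q. ?witness q (Y q) (z q) (w q)" by blast
  then show thesis
    by (intro that[of "\<lambda>a b. Y (a, b)" "\<lambda>a b. z (a, b)" "\<lambda>a b. w (a, b)"]) (simp_all split: prod.splits)
qed

lemma star_star_ball_witness:
  fixes a b :: "'b::banach"
  assumes "banach_property_star_star TYPE('b)" "(UNIV :: 'b set) \<noteq> {0}" "\<delta> > 0" "norm b \<le> 1"
  obtains Y z w where "Y \<in> dual_unit_ball" "(1 - \<delta>) * norm a \<le> Y a" "norm z \<le> 1" "norm w \<le> 1"
    "1 - \<delta> < Y z" "1 - \<delta> < Y w" "norm (b - z) + norm (b + w) \<le> 2 + \<delta>"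
proof -
  obtain Y z w where Y: "Y \<in> dual_unit_ball" "(1 - \<delta>) * norm a \<le> Y a" "norm z \<le> 1" "norm w \<le> 1"
    "1 - \<delta> < Y z" "1 - \<delta> < Y w"
    "norm (b - norm b *\<^sub>R z) + norm (b + norm b *\<^sub>R w) \<le> (2 + \<delta>) * norm b"
    using star_star_scaled_witness[OF assms(1-3)] by blast
  have "norm (b - z) \<le> norm (b - norm b *\<^sub>R z) + norm ((1 - norm b) *\<^sub>R z)"
    using norm_triangle_ineq4[of "b - norm b *\<^sub>R z" "(1 - norm b) *\<^sub>R z"] by (simp add: algebra_simps)
  moreover have "norm (b + w) \<le> norm (b + norm b *\<^sub>R w) + norm ((1 - norm b) *\<^sub>R w)"
    using norm_triangle_ineq[of "b + norm b *\<^sub>R w" "(1 - norm b) *\<^sub>R w"] by (simp add: algebra_simps)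
  moreover have "norm ((1 - norm b) *\<^sub>R z) \<le> 1 - norm b" "norm ((1 - norm b) *\<^sub>R w) \<le> 1 - norm b"
    using Y(3,4) assms(4) by (simp_all add: mult_left_le)
  moreover have "\<delta> * norm b \<le> \<delta>" using assms(3,4) by (simp add: mult_left_le)
  ultimately have "norm (b - z) + norm (b + w) \<le> 2 + \<delta>" using Y(7) by (simp add: algebra_simps)
  then show thesis using Y that by blast
qed

section \<open>Property (**) for seminormed spaces\<close>

lemma dual_sphere_normalize:
  assumes add: "\<forall>u\<in>V. \<forall>v\<in>V. y (add u v) = y u + y v"
    and scal: "\<forall>c. \<forall>u\<in>V. y (scal c u) = c * y u"
    and bound: "\<forall>z\<in>V. \<bar>y z\<bar> \<le> N z"
    and z0: "z0 \<in> V" "N z0 \<le> 1" "0 < y z0"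
  obtains y' where "y' \<in> dual_sphere V add scal N" "\<And>z. z \<in> V \<Longrightarrow> 0 < y z \<Longrightarrow> y z \<le> y' z"
proof -
  define T where "T = {\<bar>y z\<bar> | z. z \<in> V \<and> N z \<le> 1}"
  define c where "c = Sup T"
  have T_le: "t \<le> 1" if "t \<in> T" for t
    using that bound unfolding T_def by fastforce
  have "T \<noteq> {}" using z0 unfolding T_def by blast
  have "bdd_above T" using T_le by (rule bdd_aboveI)
  have "c \<le> 1" unfolding c_def using \<open>T \<noteq> {}\<close> T_le by (rule cSup_least)
  have le_c: "\<bar>y z\<bar> \<le> c" if "z \<in> V" "N z \<le> 1" for z
    unfolding c_def using that \<open>bdd_above T\<close> by (intro cSup_upper) (auto simp: T_def)
  then have "0 < c" using z0 le_c[OF z0(1,2)] by linarith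
  define y' where "y' z = y z / c" for z
  have "Sup {\<bar>y' z\<bar> | z. z \<in> V \<and> N z \<le> 1} = 1"
  proof (rule cSup_eq_non_empty)
    show "{\<bar>y' z\<bar> | z. z \<in> V \<and> N z \<le> 1} \<noteq> {}" using z0 by blast
    show "t \<le> 1" if "t \<in> {\<bar>y' z\<bar> | z. z \<in> V \<and> N z \<le> 1}" for t
      using that le_c \<open>0 < c\<close> by (auto simp: y'_def)
    show "1 \<le> B" if B: "\<And>t. t \<in> {\<bar>y' z\<bar> | z. z \<in> V \<and> N z \<le> 1} \<Longrightarrow> t \<le> B" for B
    proof -
      have "t \<le> B * c" if "t \<in> T" for t
      proof -
        obtain z where z: "t = \<bar>y z\<bar>" "z \<in> V" "N z \<le> 1" using \<open>t \<in> T\<close> by (auto simp: T_def)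
        then have "\<bar>y z\<bar> / c \<le> B" using B[of "\<bar>y' z\<bar>"] \<open>0 < c\<close> by (auto simp: y'_def)
        then show ?thesis using z \<open>0 < c\<close> by (simp add: pos_divide_le_eq)
      qed
      then have "c \<le> B * c" unfolding c_def using \<open>T \<noteq> {}\<close> by (intro cSup_least) auto
      then show ?thesis using \<open>0 < c\<close> by simp
    qed
  qed
  moreover have "\<exists>C. \<forall>z\<in>V. \<bar>y' z\<bar> \<le> C * N z"
    using bound \<open>0 < c\<close> by (intro exI[of _ "1 / c"]) (auto simp: y'_def divide_right_mono)
  ultimately have "y' \<in> dual_sphere V add scal N"
    using add scal by (simp add: dual_sphere_def y'_def add_divide_distrib)
  moreover have "y z \<le> y' z" if "0 < y z" for z
    using that \<open>0 < c\<close> \<open>c \<le> 1\<close> by (simp add: y'_def le_divide_eq mult_left_le)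
  ultimately show thesis using that by blast
qed

lemma sdist_le:
  assumes "a \<in> A" "\<And>a. a \<in> A \<Longrightarrow> 0 \<le> N (add x (scal (-1) a))"
  shows "sdist add scal N x A \<le> N (add x (scal (-1) a))"
  unfolding sdist_def using assms by (intro cInf_lower bdd_belowI[of _ 0]) auto

text \<open>Property (**) only needs a functional of norm at most one, which is then normalized,
  and one point of the slice on each side of x2.\<close>
lemma property_star_starI:
  assumes closed: "\<forall>u\<in>V. \<forall>v\<in>V. add u v \<in> V" "\<forall>u\<in>V. scal (-1) u \<in> V"
    and neg_neg: "\<forall>u. scal (-1) (scal (-1) u) = u" and nonneg: "\<forall>u\<in>V. 0 \<le> N u"
    and witness: "\<And>x1 x2 \<epsilon>. x1 \<in> V \<Longrightarrow> x2 \<in> V \<Longrightarrow> N x1 = 1 \<Longrightarrow> N x2 = 1 \<Longrightarrow> 0 < \<epsilon> \<Longrightarrow> \<epsilon> < 1 \<Longrightarrow>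
      \<exists>y h1 h2. (\<forall>u\<in>V. \<forall>v\<in>V. y (add u v) = y u + y v) \<and> (\<forall>c. \<forall>u\<in>V. y (scal c u) = c * y u) \<and>
        (\<forall>z\<in>V. \<bar>y z\<bar> \<le> N z) \<and> 1 - \<epsilon> < y x1 \<and> h1 \<in> V \<and> h2 \<in> V \<and> N h1 \<le> 1 \<and> N h2 \<le> 1 \<and>
        1 - \<epsilon> < y h1 \<and> 1 - \<epsilon> < y h2 \<and> N (add x2 (scal (-1) h1)) + N (add x2 h2) < 2 + \<epsilon>"
  shows "property_star_star V add scal N"
  unfolding property_star_star_def
proof (intro ballI impI allI)
  fix x1 x2 and \<epsilon> :: real
  assume x: "x1 \<in> V" "x2 \<in> V" "N x1 = 1" "N x2 = 1" and "\<epsilon> > 0"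
  define \<epsilon>' where "\<epsilon>' = min \<epsilon> (1/2)"
  have \<epsilon>': "0 < \<epsilon>'" "\<epsilon>' < 1" "\<epsilon>' \<le> \<epsilon>" using \<open>\<epsilon> > 0\<close> by (auto simp: \<epsilon>'_def)
  obtain y h1 h2 where y: "\<forall>u\<in>V. \<forall>v\<in>V. y (add u v) = y u + y v" "\<forall>c. \<forall>u\<in>V. y (scal c u) = c * y u"
      "\<forall>z\<in>V. \<bar>y z\<bar> \<le> N z" "1 - \<epsilon>' < y x1"
    and h: "h1 \<in> V" "h2 \<in> V" "N h1 \<le> 1" "N h2 \<le> 1" "1 - \<epsilon>' < y h1" "1 - \<epsilon>' < y h2"
    and dist: "N (add x2 (scal (-1) h1)) + N (add x2 h2) < 2 + \<epsilon>'"
    using witness[OF x \<epsilon>'(1,2)] by blast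
  obtain y' where y': "y' \<in> dual_sphere V add scal N" "\<And>z. z \<in> V \<Longrightarrow> 0 < y z \<Longrightarrow> y z \<le> y' z"
    by (rule dual_sphere_normalize[OF y(1-3) x(1)]) (use x(3) y(4) \<epsilon>' in auto)
  define S where "S = slice V N y' \<epsilon>"
  have in_S: "z \<in> S" if "z \<in> V" "N z \<le> 1" "1 - \<epsilon>' < y z" for z
    using that y'(2)[of z] \<epsilon>' by (auto simp: S_def slice_def)
  have dist_nonneg: "0 \<le> N (add x2 (scal (-1) a))" if "a \<in> S \<union> scal (-1) ` S" for a
    using that closed nonneg x(2) by (auto simp: S_def slice_def)
  have "sdist add scal N x2 S \<le> N (add x2 (scal (-1) h1))"
    using h dist_nonneg by (intro sdist_le in_S) auto
  moreover have "sdist add scal N x2 (scal (-1) ` S) \<le> N (add x2 (scal (-1) (scal (-1) h2)))"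
    using h dist_nonneg by (intro sdist_le imageI in_S) auto
  then have "sdist add scal N x2 (scal (-1) ` S) \<le> N (add x2 h2)"
    using neg_neg by simp
  ultimately show "\<exists>y\<in>dual_sphere V add scal N. x1 \<in> slice V N y \<epsilon> \<and>
      sdist add scal N x2 (slice V N y \<epsilon>) + sdist add scal N x2 (scal (-1) ` slice V N y \<epsilon>) < 2 + \<epsilon>"
    using y' in_S[of x1] x y(4) dist \<epsilon>' unfolding S_def by (intro bexI[OF _ y'(1)]) auto
qed

section \<open>The space L^1\<close>

lemma L1_setI:
  assumes "strongly_measurable M f" "integrable M (\<lambda>x. norm (f x))"
  shows "f \<in> L1_set M"
  using assms unfolding L1_set_def integrable_iff_bounded by auto

lemma integrable_norm_L1:
  assumes "complete_measure M" "f \<in> L1_set M"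
  shows "integrable M (\<lambda>x. norm (f x))"
  using assms borel_measurable_norm_strongly_measurable[OF assms(1)]
  unfolding L1_set_def integrable_iff_bounded by auto

lemma L1_norm_eq_integral:
  assumes "integrable M (\<lambda>x. norm (f x))"
  shows "L1_norm M f = (\<integral>x. norm (f x) \<partial>M)"
  unfolding L1_norm_def using nn_integral_eq_integral[OF assms] by (simp add: integral_nonneg_AE)

lemma L1_set_dominated:
  assumes "complete_measure M" "strongly_measurable M f" "integrable M g" "\<And>x. norm (f x) \<le> g x"
  shows "f \<in> L1_set M" "L1_norm M f \<le> (\<integral>x. g x \<partial>M)"
proof -
  have int: "integrable M (\<lambda>x. norm (f x))"
  proof (rule Bochner_Integration.integrable_bound[OF assms(3)])
    show "(\<lambda>x. norm (f x)) \<in> borel_measurable M"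
      by (rule borel_measurable_norm_strongly_measurable[OF assms(1,2)])
    show "AE x in M. norm (norm (f x)) \<le> norm (g x)"
      using assms(4) by (auto intro: order_trans[OF _ abs_ge_self])
  qed
  then show "f \<in> L1_set M" by (rule L1_setI[OF assms(2)])
  show "L1_norm M f \<le> (\<integral>x. g x \<partial>M)"
    using int assms(3,4) by (simp add: L1_norm_eq_integral integral_mono)
qed

lemma L1_fun_add:
  assumes "complete_measure M" "f \<in> L1_set M" "g \<in> L1_set M"
  shows "fun_add f g \<in> L1_set M"
proof (rule L1_set_dominated(1)[OF assms(1)])
  show "strongly_measurable M (fun_add f g)"
    using assms(2,3) unfolding L1_set_def fun_add_def by (auto intro: strongly_measurable_add)
  show "integrable M (\<lambda>x. norm (f x) + norm (g x))"
    using integrable_norm_L1[OF assms(1,2)] integrable_norm_L1[OF assms(1,3)]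
    by (rule Bochner_Integration.integrable_add)
  show "norm (fun_add f g x) \<le> norm (f x) + norm (g x)" for x
    by (simp add: fun_add_def norm_triangle_ineq)
qed

lemma L1_fun_scal:
  assumes "complete_measure M" "f \<in> L1_set M"
  shows "fun_scal c f \<in> L1_set M"
proof (rule L1_set_dominated(1)[OF assms(1)])
  show "strongly_measurable M (fun_scal c f)"
    using assms(2) unfolding L1_set_def fun_scal_def by (auto intro: strongly_measurable_scaleR)
  show "integrable M (\<lambda>x. \<bar>c\<bar> * norm (f x))"
    using integrable_norm_L1[OF assms] by simp
  show "norm (fun_scal c f x) \<le> \<bar>c\<bar> * norm (f x)" for x
    by (simp add: fun_scal_def)
qed

lemma L1_norm_fun_add:
  assumes "complete_measure M" "f \<in> L1_set M" "g \<in> L1_set M"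
  shows "integrable M (\<lambda>x. norm (f x + g x))" "L1_norm M (fun_add f g) = (\<integral>x. norm (f x + g x) \<partial>M)"
  using integrable_norm_L1[OF assms(1) L1_fun_add[OF assms]] L1_norm_eq_integral[of M "fun_add f g"]
  by (simp_all add: fun_add_def)

lemma L1_simple_approx:
  fixes f :: "'a \<Rightarrow> 'b::real_normed_vector"
  assumes cm: "complete_measure M" and f: "f \<in> L1_set M" and "0 < \<eta>"
  obtains t where "simple_function M t" "integrable M (\<lambda>x. norm (t x))"
    "integrable M (\<lambda>x. norm (f x - t x))" "(\<integral>x. norm (f x - t x) \<partial>M) < \<eta>"
proof -
  have smf: "strongly_measurable M f" using f by (simp add: L1_set_def)
  obtain s where s: "\<And>n. simple_function M (s n)" "AE x in M. (\<lambda>n. s n x) \<longlonglongrightarrow> f x"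
    using smf unfolding strongly_measurable_def by blast
  have [measurable]: "(\<lambda>x. norm (f x)) \<in> borel_measurable M"
    by (rule borel_measurable_norm_strongly_measurable[OF cm smf])
  have [measurable]: "(\<lambda>x. norm (s n x)) \<in> borel_measurable M" for n
    by (rule borel_measurable_simple_function) (rule simple_function_compose1[OF s(1)])
  have intf: "integrable M (\<lambda>x. norm (f x))" by (rule integrable_norm_L1[OF cm f])
  txt \<open>Truncating s n where it exceeds twice the norm of f makes 3 norm f a dominating function.\<close>
  define A where "A n = {x\<in>space M. norm (s n x) \<le> 2 * norm (f x)}" for n
  have [measurable]: "A n \<in> sets M" for n unfolding A_def by measurable
  define t where "t n x = (if x \<in> A n then s n x else 0)" for n x
  have st: "simple_function M (t n)" for n
    unfolding t_def by (rule simple_function_If_set[OF s(1)]) auto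
  have t_le: "norm (t n x) \<le> 2 * norm (f x)" for n x by (auto simp: t_def A_def)
  have meas: "(\<lambda>x. norm (f x - t n x)) \<in> borel_measurable M" for n
    by (intro borel_measurable_norm_strongly_measurable[OF cm] strongly_measurable_diff smf
        strongly_measurable_simple st)
  have bound: "AE x in M. norm (norm (f x - t n x)) \<le> 3 * norm (f x)" for n
    using norm_triangle_ineq4[of "f x" "t n x" for x] t_le[of n] by (intro AE_I2) (smt (verit) norm_ge_zero real_norm_def)
  have lim: "AE x in M. (\<lambda>n. norm (f x - t n x)) \<longlonglongrightarrow> 0"
    using s(2) AE_space
  proof eventually_elim
    fix x assume l: "(\<lambda>n. s n x) \<longlonglongrightarrow> f x" and x: "x \<in> space M"
    show "(\<lambda>n. norm (f x - t n x)) \<longlonglongrightarrow> 0"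
    proof (cases "f x = 0")
      case True
      then show ?thesis using t_le[of _ x] by simp
    next
      case False
      then have "\<forall>\<^sub>F n in sequentially. norm (s n x) < 2 * norm (f x)"
        by (intro order_tendstoD(2)[OF tendsto_norm[OF l]]) simp
      then have "\<forall>\<^sub>F n in sequentially. norm (f x - s n x) = norm (f x - t n x)"
        by eventually_elim (use x in \<open>auto simp: t_def A_def\<close>)
      moreover have "(\<lambda>n. norm (f x - s n x)) \<longlonglongrightarrow> 0"
        using tendsto_norm_zero[OF LIM_zero[OF l]] by (simp add: norm_minus_commute)
      ultimately show ?thesis by (rule Lim_transform_eventually[rotated])
    qed
  qed
  have "(\<lambda>n. \<integral>x. norm (f x - t n x) \<partial>M) \<longlonglongrightarrow> (\<integral>x. 0 \<partial>M)"
    by (rule integral_dominated_convergence[where w="\<lambda>x. 3 * norm (f x)"])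
       (use meas intf lim bound in auto)
  then have "\<forall>\<^sub>F n in sequentially. (\<integral>x. norm (f x - t n x) \<partial>M) < \<eta>"
    using \<open>0 < \<eta>\<close> by (intro order_tendstoD(2)) auto
  then obtain n where n: "(\<integral>x. norm (f x - t n x) \<partial>M) < \<eta>"
    by (auto simp: eventually_sequentially)
  have "integrable M (\<lambda>x. norm (f x - t n x))"
    by (rule integrable_dominated_convergence2[where w="\<lambda>x. 3 * norm (f x)" and f="\<lambda>x. 0"])
       (use meas intf lim bound in auto)
  moreover have "integrable M (\<lambda>x. norm (t n x))"
    by (rule Bochner_Integration.integrable_bound[where f="\<lambda>x. 2 * norm (f x)"])
      (use intf t_le borel_measurable_simple_function[OF simple_function_compose1[OF st]] in auto)
  ultimately show thesis using that st n by blast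
qed

text \<open>Rescaling the approximant to norm one costs at most its distance to f once more.\<close>
lemma L1_unit_simple_approx:
  fixes f :: "'a \<Rightarrow> 'b::real_normed_vector"
  assumes cm: "complete_measure M" and f: "f \<in> L1_set M" "L1_norm M f = 1" and "0 < \<eta>"
  obtains t where "simple_function M t" "integrable M (\<lambda>x. norm (t x))" "(\<integral>x. norm (t x) \<partial>M) = 1"
    "integrable M (\<lambda>x. norm (f x - t x))" "(\<integral>x. norm (f x - t x) \<partial>M) < \<eta>"
proof -
  have intf: "integrable M (\<lambda>x. norm (f x))" by (rule integrable_norm_L1[OF cm f(1)])
  have f1: "(\<integral>x. norm (f x) \<partial>M) = 1" using f(2) by (simp add: L1_norm_eq_integral[OF intf])
  obtain t0 where t0: "simple_function M t0" "integrable M (\<lambda>x. norm (t0 x))"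
    "integrable M (\<lambda>x. norm (f x - t0 x))" "(\<integral>x. norm (f x - t0 x) \<partial>M) < min (\<eta> / 2) (1 / 2)"
    using L1_simple_approx[OF cm f(1), of "min (\<eta> / 2) (1 / 2)"] \<open>0 < \<eta>\<close> by auto
  define d where "d = (\<integral>x. norm (f x - t0 x) \<partial>M)"
  define s where "s = (\<integral>x. norm (t0 x) \<partial>M)"
  have "s \<le> 1 + d"
  proof -
    have "norm (t0 x) \<le> norm (f x) + norm (f x - t0 x)" for x
      using norm_triangle_ineq2[of "t0 x" "f x"] by (simp add: norm_minus_commute)
    then have "s \<le> (\<integral>x. norm (f x) + norm (f x - t0 x) \<partial>M)"
      unfolding s_def using t0(2,3) intf by (intro integral_mono) auto
    then show ?thesis using intf t0(3) f1 by (simp add: d_def)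
  qed
  moreover have "1 \<le> s + d"
  proof -
    have "norm (f x) \<le> norm (t0 x) + norm (f x - t0 x)" for x
      using norm_triangle_ineq2[of "f x" "t0 x"] by simp
    then have "1 \<le> (\<integral>x. norm (t0 x) + norm (f x - t0 x) \<partial>M)"
      unfolding f1[symmetric] using t0(2,3) intf by (intro integral_mono) auto
    then show ?thesis using t0(2,3) by (simp add: d_def s_def)
  qed
  ultimately have s: "\<bar>s - 1\<bar> \<le> d" "0 < s" using t0(4) by (auto simp: d_def)
  define t where "t x = (1 / s) *\<^sub>R t0 x" for x
  have "simple_function M t"
    unfolding t_def by (rule simple_function_compose1[OF t0(1)])
  moreover have "integrable M (\<lambda>x. norm (t x))" "(\<integral>x. norm (t x) \<partial>M) = 1"
    using t0(2) s(2) by (simp_all add: t_def s_def)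
  moreover have dist: "norm (f x - t x) \<le> norm (f x - t0 x) + \<bar>s - 1\<bar> / s * norm (t0 x)" for x
  proof -
    have "f x - t x = (f x - t0 x) + ((s - 1) / s) *\<^sub>R t0 x"
      using s(2) by (simp add: t_def algebra_simps diff_divide_distrib)
    then have "norm (f x - t x) \<le> norm (f x - t0 x) + norm (((s - 1) / s) *\<^sub>R t0 x)"
      by (metis norm_triangle_ineq)
    also have "norm (((s - 1) / s) *\<^sub>R t0 x) = \<bar>s - 1\<bar> / s * norm (t0 x)"
      using s(2) by (simp add: abs_divide)
    finally show ?thesis .
  qed
  moreover have int: "integrable M (\<lambda>x. norm (f x - t x))"
  proof (rule Bochner_Integration.integrable_bound)
    show "integrable M (\<lambda>x. norm (f x - t0 x) + \<bar>s - 1\<bar> / s * norm (t0 x))"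
      using t0(2,3) by simp
    show "(\<lambda>x. norm (f x - t x)) \<in> borel_measurable M"
      using f(1) strongly_measurable_simple[OF \<open>simple_function M t\<close>] unfolding L1_set_def
      by (intro borel_measurable_norm_strongly_measurable[OF cm] strongly_measurable_diff) auto
    show "AE x in M. norm (norm (f x - t x)) \<le> norm (norm (f x - t0 x) + \<bar>s - 1\<bar> / s * norm (t0 x))"
      using dist by (intro AE_I2) (smt (verit) norm_ge_zero real_norm_def divide_nonneg_nonneg abs_ge_zero
          mult_nonneg_nonneg less_imp_le[OF s(2)])
  qed
  moreover have "(\<integral>x. norm (f x - t x) \<partial>M) < \<eta>"
  proof -
    have "(\<integral>x. norm (f x - t x) \<partial>M) \<le> (\<integral>x. norm (f x - t0 x) + \<bar>s - 1\<bar> / s * norm (t0 x) \<partial>M)"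
      using int t0(2,3) dist by (intro integral_mono) auto
    also have "\<dots> = d + \<bar>s - 1\<bar>"
      using t0(2,3) s(2) by (simp add: d_def s_def)
    finally show ?thesis using s(1) t0(4) by (simp add: d_def)
  qed
  ultimately show thesis using that by blast
qed

lemma L1_dual_family_functional:
  fixes \<Phi> :: "'c \<Rightarrow> 'b::real_normed_vector \<Rightarrow> real" and p :: "'a \<Rightarrow> 'c"
  assumes cm: "complete_measure M" and p: "simple_function M p" and \<Phi>: "\<And>v. \<Phi> v \<in> dual_unit_ball"
  defines "y \<equiv> \<lambda>h. \<integral>x. \<Phi> (p x) (h x) \<partial>M"
  shows "\<forall>u\<in>L1_set M. \<forall>v\<in>L1_set M. y (fun_add u v) = y u + y v"
    and "\<forall>c. \<forall>u\<in>L1_set M. y (fun_scal c u) = c * y u"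
    and "\<forall>h\<in>L1_set M. \<bar>y h\<bar> \<le> L1_norm M h"
    and "\<And>h :: 'a \<Rightarrow> 'b. h \<in> L1_set M \<Longrightarrow> integrable M (\<lambda>x. \<Phi> (p x) (h x))"
proof -
  show int: "integrable M (\<lambda>x. \<Phi> (p x) (h x))" if h: "h \<in> L1_set M" for h :: "'a \<Rightarrow> 'b"
  proof (rule Bochner_Integration.integrable_bound)
    show "integrable M (\<lambda>x. norm (h x))" by (rule integrable_norm_L1[OF cm h])
    show "(\<lambda>x. \<Phi> (p x) (h x)) \<in> borel_measurable M"
      using h unfolding L1_set_def
      by (intro borel_measurable_simple_parametric[OF p, of "\<lambda>v x. \<Phi> v (h x)"]
          borel_measurable_continuous_comp_strongly_measurable[OF cm] dual_unit_ball_continuous \<Phi>) auto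
    show "AE x in M. norm (\<Phi> (p x) (h x)) \<le> norm (norm (h x))"
      using dual_unit_ballD(3)[OF \<Phi>] by auto
  qed
  show "\<forall>u\<in>L1_set M. \<forall>v\<in>L1_set M. y (fun_add u v) = y u + y v"
    using int by (simp add: y_def fun_add_def dual_unit_ballD(1)[OF \<Phi>])
  show "\<forall>c. \<forall>u\<in>L1_set M. y (fun_scal c u) = c * y u"
    by (simp add: y_def fun_scal_def dual_unit_ballD(2)[OF \<Phi>])
  show "\<forall>h\<in>L1_set M. \<bar>y h\<bar> \<le> L1_norm M h"
  proof
    fix h :: "'a \<Rightarrow> 'b" assume h: "h \<in> L1_set M"
    have "\<bar>y h\<bar> \<le> (\<integral>x. \<bar>\<Phi> (p x) (h x)\<bar> \<partial>M)"
      using integral_norm_bound[of M "\<lambda>x. \<Phi> (p x) (h x)"] by (simp add: y_def)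
    also have "\<dots> \<le> (\<integral>x. norm (h x) \<partial>M)"
      using int[OF h] integrable_norm_L1[OF cm h] dual_unit_ballD(3)[OF \<Phi>] by (intro integral_mono) auto
    finally show "\<bar>y h\<bar> \<le> L1_norm M h"
      by (simp add: L1_norm_eq_integral[OF integrable_norm_L1[OF cm h]])
  qed
qed

lemma L1_slice_distance_bound:
  fixes f t h1 h2 :: "'a \<Rightarrow> 'b::real_normed_vector"
  assumes cm: "complete_measure M" and f: "f \<in> L1_set M" and h: "h1 \<in> L1_set M" "h2 \<in> L1_set M"
    and t: "integrable M (\<lambda>x. norm (t x))" "(\<integral>x. norm (t x) \<partial>M) = 1"
      "integrable M (\<lambda>x. norm (f x - t x))" "(\<integral>x. norm (f x - t x) \<partial>M) < \<eta>"
    and pointwise: "\<And>x. norm (t x - h1 x) + norm (t x + h2 x) \<le> (2 + \<eta>) * norm (t x)"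
  shows "L1_norm M (fun_add f (fun_scal (-1) h1)) + L1_norm M (fun_add f h2) < 2 + 3 * \<eta>"
proof -
  note d1 = L1_norm_fun_add[OF cm f L1_fun_scal[OF cm h(1)], of "-1", unfolded fun_scal_def]
  note d2 = L1_norm_fun_add[OF cm f h(2)]
  have "norm (f x - h1 x) + norm (f x + h2 x) \<le> 2 * norm (f x - t x) + (2 + \<eta>) * norm (t x)" for x
    using norm_triangle_ineq[of "f x - t x" "t x - h1 x"] norm_triangle_ineq[of "f x - t x" "t x + h2 x"]
      pointwise[of x] by simp
  then have "(\<integral>x. norm (f x - h1 x) + norm (f x + h2 x) \<partial>M)
      \<le> (\<integral>x. 2 * norm (f x - t x) + (2 + \<eta>) * norm (t x) \<partial>M)"
    using d1(1) d2(1) t(1,3) by (intro integral_mono) auto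
  also have "\<dots> < 2 + 3 * \<eta>"
    using t by simp
  finally show ?thesis
    using d1 d2 by (simp add: fun_scal_def)
qed

text \<open>Approximate f1, f2 by simple functions t1, t2 of norm one, choose the pointwise witnesses
  of (**) in X at the finitely many values of (t1, t2), and integrate them.\<close>
lemma L1_star_star_witness:
  fixes f1 f2 :: "'a \<Rightarrow> 'b::banach"
  assumes cm: "complete_measure M" and H: "banach_property_star_star TYPE('b)"
    and f1: "f1 \<in> L1_set M" "L1_norm M f1 = 1" and f2: "f2 \<in> L1_set M" "L1_norm M f2 = 1"
    and "0 < \<epsilon>"
  obtains y h1 h2 where
    "\<forall>u\<in>L1_set M. \<forall>v\<in>L1_set M. y (fun_add u v) = y u + y v"
    "\<forall>c. \<forall>u\<in>L1_set M. y (fun_scal c u) = c * y u"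
    "\<forall>z\<in>L1_set M. \<bar>y z\<bar> \<le> L1_norm M z" "1 - \<epsilon> < y f1"
    "h1 \<in> L1_set M" "h2 \<in> L1_set M" "L1_norm M h1 \<le> 1" "L1_norm M h2 \<le> 1"
    "1 - \<epsilon> < y h1" "1 - \<epsilon> < y h2"
    "L1_norm M (fun_add f2 (fun_scal (-1) h1)) + L1_norm M (fun_add f2 h2) < 2 + \<epsilon>"
proof -
  define \<eta> where "\<eta> = \<epsilon> / 3"
  have "0 < \<eta>" using \<open>0 < \<epsilon>\<close> by (simp add: \<eta>_def)
  have "(UNIV :: 'b set) \<noteq> {0}"
  proof
    assume "(UNIV :: 'b set) = {0}"
    then have "f1 = (\<lambda>x. 0)" by auto
    then show False using f1(2) by (simp add: L1_norm_def)
  qed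
  obtain t1 where t1: "simple_function M t1" "integrable M (\<lambda>x. norm (t1 x))" "(\<integral>x. norm (t1 x) \<partial>M) = 1"
    "integrable M (\<lambda>x. norm (f1 x - t1 x))" "(\<integral>x. norm (f1 x - t1 x) \<partial>M) < \<eta>"
    using L1_unit_simple_approx[OF cm f1 \<open>0 < \<eta>\<close>] by blast
  obtain t2 where t2: "simple_function M t2" "integrable M (\<lambda>x. norm (t2 x))" "(\<integral>x. norm (t2 x) \<partial>M) = 1"
    "integrable M (\<lambda>x. norm (f2 x - t2 x))" "(\<integral>x. norm (f2 x - t2 x) \<partial>M) < \<eta>"
    using L1_unit_simple_approx[OF cm f2 \<open>0 < \<eta>\<close>] by blast
  obtain Y :: "'b \<Rightarrow> 'b \<Rightarrow> 'b \<Rightarrow> real" and z w where Y: "\<And>a b. Y a b \<in> dual_unit_ball"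
    "\<And>a b. (1 - \<eta>) * norm a \<le> Y a b a" "\<And>a b. norm (z a b) \<le> 1" "\<And>a b. norm (w a b) \<le> 1"
    "\<And>a b. 1 - \<eta> < Y a b (z a b)" "\<And>a b. 1 - \<eta> < Y a b (w a b)"
    "\<And>a b. norm (b - norm b *\<^sub>R z a b) + norm (b + norm b *\<^sub>R w a b) \<le> (2 + \<eta>) * norm b"
    using star_star_scaled_witness_family[OF H \<open>UNIV \<noteq> {0}\<close> \<open>0 < \<eta>\<close>] by blast
  define p where "p x = (t1 x, t2 x)" for x
  have p: "simple_function M p" unfolding p_def by (rule simple_function_Pair[OF t1(1) t2(1)])
  define y where "y h = (\<integral>x. Y (t1 x) (t2 x) (h x) \<partial>M)" for h :: "'a \<Rightarrow> 'b"
  note y = L1_dual_family_functional[where \<Phi> = "\<lambda>q. Y (fst q) (snd q)", OF cm p Y(1),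
      unfolded p_def fst_conv snd_conv, folded y_def]
  define h1 where "h1 x = norm (t2 x) *\<^sub>R z (t1 x) (t2 x)" for x
  define h2 where "h2 x = norm (t2 x) *\<^sub>R w (t1 x) (t2 x)" for x
  have "simple_function M h1" "simple_function M h2"
    using simple_function_compose1[OF p, of "\<lambda>q. norm (snd q) *\<^sub>R z (fst q) (snd q)"]
      simple_function_compose1[OF p, of "\<lambda>q. norm (snd q) *\<^sub>R w (fst q) (snd q)"]
    by (simp_all add: h1_def[abs_def] h2_def[abs_def] p_def)
  moreover have "norm (h1 x) \<le> norm (t2 x)" "norm (h2 x) \<le> norm (t2 x)" for x
    using Y(3,4) by (simp_all add: h1_def h2_def mult_left_le)
  ultimately have h: "h1 \<in> L1_set M" "h2 \<in> L1_set M" "L1_norm M h1 \<le> 1" "L1_norm M h2 \<le> 1"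
    using L1_set_dominated[OF cm strongly_measurable_simple t2(2)] t2(3) by metis+
  have "(1 - \<eta>) * norm (t1 x) - norm (f1 x - t1 x) \<le> Y (t1 x) (t2 x) (f1 x)" for x
    using Y(2)[of "t1 x" "t2 x"] dual_unit_ball_ge[OF Y(1), of "t1 x" "t2 x" "t1 x" "f1 x"] by linarith
  then have "(\<integral>x. (1 - \<eta>) * norm (t1 x) - norm (f1 x - t1 x) \<partial>M) \<le> y f1"
    unfolding y_def using t1(2,4) y(4)[OF f1(1)] by (intro integral_mono) auto
  then have "1 - \<epsilon> < y f1" using t1(2-5) \<open>0 < \<epsilon>\<close> by (simp add: \<eta>_def)
  have "(1 - \<eta>) * norm (t2 x) \<le> Y (t1 x) (t2 x) (z (t1 x) (t2 x)) * norm (t2 x)"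
    "(1 - \<eta>) * norm (t2 x) \<le> Y (t1 x) (t2 x) (w (t1 x) (t2 x)) * norm (t2 x)" for x
    using Y(5,6)[of "t1 x" "t2 x"] by (auto intro: mult_right_mono)
  then have "(1 - \<eta>) * norm (t2 x) \<le> Y (t1 x) (t2 x) (h1 x)" "(1 - \<eta>) * norm (t2 x) \<le> Y (t1 x) (t2 x) (h2 x)" for x
    using dual_unit_ballD(2)[OF Y(1)] by (simp_all add: h1_def h2_def mult.commute)
  then have "(\<integral>x. (1 - \<eta>) * norm (t2 x) \<partial>M) \<le> y h1" "(\<integral>x. (1 - \<eta>) * norm (t2 x) \<partial>M) \<le> y h2"
    unfolding y_def using t2(2) y(4)[OF h(1)] y(4)[OF h(2)] by (intro integral_mono; simp)+
  then have "1 - \<epsilon> < y h1" "1 - \<epsilon> < y h2" using t2(3) \<open>0 < \<epsilon>\<close> by (simp_all add: \<eta>_def)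
  have "L1_norm M (fun_add f2 (fun_scal (-1) h1)) + L1_norm M (fun_add f2 h2) < 2 + 3 * \<eta>"
    by (rule L1_slice_distance_bound[OF cm f2(1) h(1,2) t2(2-5)]) (use Y(7) in \<open>simp add: h1_def h2_def\<close>)
  then show thesis
    using that y(1-3) h \<open>1 - \<epsilon> < y f1\<close> \<open>1 - \<epsilon> < y h1\<close> \<open>1 - \<epsilon> < y h2\<close> by (simp add: \<eta>_def)
qed

lemma L1_property_star_star:
  fixes M :: "'a measure"
  assumes "complete_measure M" "banach_property_star_star TYPE('b::banach)"
  shows "property_star_star (L1_set M :: ('a \<Rightarrow> 'b) set) fun_add fun_scal (L1_norm M)"
proof (rule property_star_starI)
  show "\<forall>u\<in>L1_set M. \<forall>v\<in>L1_set M. fun_add u v \<in> (L1_set M :: ('a \<Rightarrow> 'b) set)"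
    using L1_fun_add[OF assms(1)] by blast
  show "\<forall>u\<in>L1_set M. fun_scal (-1) u \<in> (L1_set M :: ('a \<Rightarrow> 'b) set)"
    using L1_fun_scal[OF assms(1)] by blast
  show "\<forall>u::'a \<Rightarrow> 'b. fun_scal (-1) (fun_scal (-1) u) = u" by (simp add: fun_scal_def)
  show "\<forall>u\<in>L1_set M. 0 \<le> L1_norm M u" by (simp add: L1_norm_def)
qed (rule L1_star_star_witness[OF assms], assumption+, intro exI conjI, assumption+)

section \<open>The space L^infinity\<close>

lemma Linf_norm_le:
  assumes "0 \<le> C" "AE x in M. norm (f x) \<le> C"
  shows "Linf_norm M f \<le> C"
  unfolding Linf_norm_def by (rule cInf_lower) (use assms in \<open>auto intro: bdd_belowI[of _ 0]\<close>)

lemma Linf_norm_bounds_nonempty: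
  assumes "f \<in> Linf_set M"
  shows "{C. 0 \<le> C \<and> (AE x in M. norm (f x) \<le> C)} \<noteq> {}"
proof -
  obtain C where "AE x in M. norm (f x) \<le> C" using assms by (auto simp: Linf_set_def)
  then have "AE x in M. norm (f x) \<le> max C 0" by eventually_elim auto
  then show ?thesis by (intro ex_in_conv[THEN iffD1] exI[of _ "max C 0"]) auto
qed

lemma Linf_norm_nonneg: "f \<in> Linf_set M \<Longrightarrow> 0 \<le> Linf_norm M f"
  unfolding Linf_norm_def by (rule cInf_greatest[OF Linf_norm_bounds_nonempty]) auto

lemma AE_norm_le_Linf_norm:
  assumes f: "f \<in> Linf_set M"
  shows "AE x in M. norm (f x) \<le> Linf_norm M f"
proof -
  define K where "K = {C. 0 \<le> C \<and> (AE x in M. norm (f x) \<le> C)}"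
  have "K \<noteq> {}" using Linf_norm_bounds_nonempty[OF f] by (simp add: K_def)
  have "\<exists>C\<in>K. C < Inf K + inverse (real (Suc n))" for n
    using cInf_lessD[OF \<open>K \<noteq> {}\<close>, of "Inf K + inverse (real (Suc n))"] by simp
  then obtain C where C: "\<And>n. C n \<in> K" "\<And>n. C n < Inf K + inverse (real (Suc n))" by metis
  have "AE x in M. \<forall>n. norm (f x) \<le> C n"
    unfolding AE_all_countable using C(1) by (auto simp: K_def)
  then show ?thesis
  proof eventually_elim
    fix x assume le: "\<forall>n. norm (f x) \<le> C n"
    show "norm (f x) \<le> Linf_norm M f" unfolding Linf_norm_def K_def[symmetric]
    proof (rule field_le_epsilon)
      fix e :: real assume "0 < e"
      then obtain n where "inverse (real (Suc n)) < e" using reals_Archimedean by blast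
      then show "norm (f x) \<le> Inf K + e" using le C(2)[of n] by (metis add_le_cancel_left less_eq_real_def order_trans)
    qed
  qed
qed

lemma Linf_setI: "strongly_measurable M f \<Longrightarrow> AE x in M. norm (f x) \<le> C \<Longrightarrow> f \<in> Linf_set M"
  unfolding Linf_set_def by auto

lemma Linf_fun_add:
  assumes f: "f \<in> Linf_set M" and g: "g \<in> Linf_set M"
  shows "fun_add f g \<in> Linf_set M"
proof (rule Linf_setI)
  show "strongly_measurable M (fun_add f g)"
    using f g unfolding fun_add_def Linf_set_def by (auto intro: strongly_measurable_add)
  show "AE x in M. norm (fun_add f g x) \<le> Linf_norm M f + Linf_norm M g"
    using AE_norm_le_Linf_norm[OF f] AE_norm_le_Linf_norm[OF g]
    by eventually_elim (auto simp: fun_add_def intro: order_trans[OF norm_triangle_ineq])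
qed

lemma Linf_fun_scal:
  assumes f: "f \<in> Linf_set M"
  shows "fun_scal c f \<in> Linf_set M"
proof (rule Linf_setI)
  show "strongly_measurable M (fun_scal c f)"
    using f unfolding fun_scal_def Linf_set_def by (auto intro: strongly_measurable_scaleR)
  show "AE x in M. norm (fun_scal c f x) \<le> \<bar>c\<bar> * Linf_norm M f"
    using AE_norm_le_Linf_norm[OF f] by eventually_elim (auto simp: fun_scal_def intro: mult_left_mono)
qed

lemma strongly_measurable_separably_valued:
  assumes "strongly_measurable M f"
  obtains D where "countable D" "AE x in M. \<forall>\<delta>>0. \<exists>a\<in>D. norm (f x - a) < \<delta>"
proof -
  obtain s where s: "\<And>n. simple_function M (s n)" "AE x in M. (\<lambda>n. s n x) \<longlonglongrightarrow> f x"
    using assms unfolding strongly_measurable_def by blast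
  have "countable (\<Union>n. s n ` space M)"
    using s(1) by (auto simp: simple_function_def intro: countable_finite)
  moreover have "AE x in M. \<forall>\<delta>>0. \<exists>a\<in>(\<Union>n. s n ` space M). norm (f x - a) < \<delta>"
    using s(2) AE_space
  proof eventually_elim
    case (elim x)
    show ?case
    proof (intro allI impI)
      fix \<delta> :: real assume "0 < \<delta>"
      then obtain n where "norm (s n x - f x) < \<delta>" using elim(1) unfolding LIMSEQ_iff by blast
      then show "\<exists>a\<in>(\<Union>n. s n ` space M). norm (f x - a) < \<delta>"
        using elim(2) by (auto simp: norm_minus_commute)
    qed
  qed
  ultimately show thesis by (rule that)
qed

lemma AE_bex_nonnull:
  assumes "A \<in> sets M" "emeasure M A \<noteq> 0" "AE x in M. P x"
  shows "\<exists>x\<in>A. P x"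
proof (rule ccontr)
  assume "\<not> (\<exists>x\<in>A. P x)"
  obtain N where N: "{x\<in>space M. \<not> P x} \<subseteq> N" "N \<in> sets M" "emeasure M N = 0"
    using assms(3) by (auto elim: AE_E)
  have "A \<subseteq> N" using N(1) \<open>\<not> (\<exists>x\<in>A. P x)\<close> sets.sets_into_space[OF assms(1)] by auto
  then have "emeasure M A \<le> emeasure M N" using N(2) by (rule emeasure_mono)
  then show False using N(3) assms(2) by simp
qed

text \<open>A countable cover by sets of finite measure, together with countable sets of approximate
  values of f and g, splits the set where f is large into countably many pieces on which f and
  g are nearly constant; one of them has positive measure.\<close>
lemma strongly_measurable_localize:
  fixes f g :: "'a \<Rightarrow> 'b::real_normed_vector"
  assumes cm: "complete_measure M" and sf: "sigma_finite_measure M"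
    and f: "strongly_measurable M f" and g: "strongly_measurable M g"
    and large: "\<not> (AE x in M. norm (f x) \<le> r)" and "0 < \<delta>"
  obtains A a b where "A \<in> sets M" "0 < emeasure M A" "emeasure M A < \<infinity>"
    "\<And>x. x \<in> A \<Longrightarrow> r < norm (f x) \<and> norm (f x - a) < \<delta> \<and> norm (g x - b) < \<delta>"
proof -
  obtain D1 where D1: "countable D1" "AE x in M. \<forall>\<delta>>0. \<exists>a\<in>D1. norm (f x - a) < \<delta>"
    using strongly_measurable_separably_valued[OF f] .
  obtain D2 where D2: "countable D2" "AE x in M. \<forall>\<delta>>0. \<exists>b\<in>D2. norm (g x - b) < \<delta>"
    using strongly_measurable_separably_valued[OF g] .
  obtain Fam where Fam: "countable Fam" "Fam \<subseteq> sets M" "\<Union>Fam = space M" "\<forall>F\<in>Fam. emeasure M F \<noteq> \<infinity>"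
    using sigma_finite_measure.sigma_finite_countable[OF sf] by blast
  define I where "I = D1 \<times> D2 \<times> Fam"
  define B where "B q = {x\<in>space M. r < norm (f x) \<and> norm (f x - fst q) < \<delta> \<and> norm (g x - fst (snd q)) < \<delta>}
    \<inter> snd (snd q)" for q
  have B: "B q \<in> sets M" if "q \<in> I" for q
  proof -
    have [measurable]: "(\<lambda>x. norm (f x)) \<in> borel_measurable M"
      "(\<lambda>x. norm (f x - fst q)) \<in> borel_measurable M" "(\<lambda>x. norm (g x - fst (snd q))) \<in> borel_measurable M"
      using strongly_measurable_diff[OF f strongly_measurable_simple[OF simple_function_const]]
        strongly_measurable_diff[OF g strongly_measurable_simple[OF simple_function_const]]
      by (auto intro: borel_measurable_norm_strongly_measurable[OF cm] f)
    have [measurable]: "snd (snd q) \<in> sets M" using that Fam(2) by (auto simp: I_def)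
    show ?thesis unfolding B_def by measurable
  qed
  have "\<exists>q\<in>I. emeasure M (B q) \<noteq> 0"
  proof (rule ccontr)
    assume "\<not> (\<exists>q\<in>I. emeasure M (B q) \<noteq> 0)"
    then have "(\<Union>q\<in>I. B q) \<in> null_sets M"
      using B by (intro null_sets_UN') (auto simp: I_def Fam(1) D1(1) D2(1))
    from AE_not_in[OF this] D1(2) D2(2) AE_space have "AE x in M. norm (f x) \<le> r"
    proof eventually_elim
      case (elim x)
      show "norm (f x) \<le> r"
      proof (rule ccontr)
        assume "\<not> norm (f x) \<le> r"
        obtain a b F where "a \<in> D1" "norm (f x - a) < \<delta>" "b \<in> D2" "norm (g x - b) < \<delta>" "F \<in> Fam" "x \<in> F"
          using elim \<open>0 < \<delta>\<close> Fam(3) by blast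
        then have "x \<in> (\<Union>q\<in>I. B q)"
          using elim(4) \<open>\<not> norm (f x) \<le> r\<close> by (auto simp: I_def B_def intro!: bexI[of _ "(a, b, F)"])
        then show False using elim(1) by blast
      qed
    qed
    then show False using large by blast
  qed
  then obtain a b F where q: "(a, b, F) \<in> I" "emeasure M (B (a, b, F)) \<noteq> 0" by auto
  show thesis
  proof (rule that)
    show "B (a, b, F) \<in> sets M" by (rule B[OF q(1)])
    show "0 < emeasure M (B (a, b, F))" using q(2) by (simp add: zero_less_iff_neq_zero)
    have "emeasure M (B (a, b, F)) \<le> emeasure M F"
      using q(1) Fam(2) by (intro emeasure_mono) (auto simp: B_def I_def)
    also have "\<dots> < \<infinity>" using q(1) Fam(4) by (simp add: I_def less_top)
    finally show "emeasure M (B (a, b, F)) < \<infinity>" .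
    show "r < norm (f x) \<and> norm (f x - a) < \<delta> \<and> norm (g x - b) < \<delta>" if "x \<in> B (a, b, F)" for x
      using that by (simp add: B_def)
  qed
qed

lemma Linf_norm_one_localize:
  fixes f1 f2 :: "'a \<Rightarrow> 'b::real_normed_vector"
  assumes cm: "complete_measure M" and sf: "sigma_finite_measure M"
    and f1: "f1 \<in> Linf_set M" "Linf_norm M f1 = 1" and f2: "f2 \<in> Linf_set M" "Linf_norm M f2 = 1"
    and "0 < \<delta>" "\<delta> < 1"
  obtains A a b where "A \<in> sets M" "0 < emeasure M A" "emeasure M A < \<infinity>" "1 - 2 * \<delta> < norm a"
    "norm b \<le> 1" "\<And>x. x \<in> A \<Longrightarrow> norm (f1 x - a) < \<delta>" "\<And>x. x \<in> A \<Longrightarrow> norm (f2 x - b) < 2 * \<delta>"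
proof -
  have sm: "strongly_measurable M f1" "strongly_measurable M f2"
    using f1(1) f2(1) by (simp_all add: Linf_set_def)
  have "\<not> (AE x in M. norm (f1 x) \<le> 1 - \<delta>)"
  proof
    assume "AE x in M. norm (f1 x) \<le> 1 - \<delta>"
    then have "Linf_norm M f1 \<le> 1 - \<delta>" using \<open>\<delta> < 1\<close> by (intro Linf_norm_le) auto
    then show False using f1(2) \<open>0 < \<delta>\<close> by simp
  qed
  then obtain A a b where A: "A \<in> sets M" "0 < emeasure M A" "emeasure M A < \<infinity>"
    and near: "\<And>x. x \<in> A \<Longrightarrow> 1 - \<delta> < norm (f1 x) \<and> norm (f1 x - a) < \<delta> \<and> norm (f2 x - b) < \<delta>"
    using strongly_measurable_localize[OF cm sf sm] \<open>0 < \<delta>\<close> by metis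
  have "AE x in M. norm (f2 x) \<le> 1" using AE_norm_le_Linf_norm[OF f2(1)] f2(2) by simp
  then obtain x0 where x0: "x0 \<in> A" "norm (f2 x0) \<le> 1"
    using AE_bex_nonnull[OF A(1)] A(2) by (auto simp: zero_less_iff_neq_zero)
  have "1 - 2 * \<delta> < norm a"
    using near[OF x0(1)] norm_triangle_ineq2[of "f1 x0" a] by linarith
  have "norm b < 1 + \<delta>"
    using near[OF x0(1)] x0(2) norm_triangle_ineq2[of b "f2 x0"] norm_minus_commute[of b "f2 x0"] by linarith
  define b' where "b' = (1 / (1 + \<delta>)) *\<^sub>R b"
  have "norm b' \<le> 1"
    using \<open>norm b < 1 + \<delta>\<close> \<open>0 < \<delta>\<close> by (simp add: b'_def divide_le_eq)
  have "norm (b - b') < \<delta>"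
  proof -
    have "1 - 1 / (1 + \<delta>) = \<delta> / (1 + \<delta>)" using \<open>0 < \<delta>\<close> by (simp add: field_simps)
    then have "b - b' = (\<delta> / (1 + \<delta>)) *\<^sub>R b" by (metis b'_def scaleR_diff_left scaleR_one)
    then have "norm (b - b') = \<delta> / (1 + \<delta>) * norm b" using \<open>0 < \<delta>\<close> by simp
    also have "\<dots> < \<delta>"
      using mult_strict_left_mono[OF \<open>norm b < 1 + \<delta>\<close> \<open>0 < \<delta>\<close>] \<open>0 < \<delta>\<close> by (simp add: field_simps)
    finally show ?thesis .
  qed
  show thesis
  proof (rule that[OF A \<open>1 - 2 * \<delta> < norm a\<close> \<open>norm b' \<le> 1\<close>])
    show "norm (f1 x - a) < \<delta>" if "x \<in> A" for x
      using near[OF that] by blast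
    show "norm (f2 x - b') < 2 * \<delta>" if "x \<in> A" for x
      using near[OF that] norm_triangle_ineq[of "f2 x - b" "b - b'"] \<open>norm (b - b') < \<delta>\<close> by simp
  qed
qed

lemma Linf_set_patch:
  assumes "strongly_measurable M f" "AE x in M. norm (f x) \<le> 1" "A \<in> sets M" "norm z \<le> 1"
  shows "(\<lambda>x. if x \<in> A then z else f x) \<in> Linf_set M" "Linf_norm M (\<lambda>x. if x \<in> A then z else f x) \<le> 1"
proof -
  have "AE x in M. norm (if x \<in> A then z else f x) \<le> 1"
    using assms(2) by eventually_elim (use assms(4) in auto)
  moreover have "strongly_measurable M (\<lambda>x. if x \<in> A then z else f x)"
    by (rule strongly_measurable_If[OF strongly_measurable_simple[OF simple_function_const] assms(1,3)])
  ultimately show "(\<lambda>x. if x \<in> A then z else f x) \<in> Linf_set M" "Linf_norm M (\<lambda>x. if x \<in> A then z else f x) \<le> 1"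
    by (auto intro: Linf_setI Linf_norm_le)
qed

lemma Linf_average_functional:
  fixes Y :: "'b::real_normed_vector \<Rightarrow> real"
  assumes cm: "complete_measure M" and A: "A \<in> sets M" "0 < emeasure M A" "emeasure M A < \<infinity>"
    and Y: "Y \<in> dual_unit_ball"
  defines "y \<equiv> \<lambda>h :: 'a \<Rightarrow> 'b. (\<integral>x. indicator A x * Y (h x) \<partial>M) / measure M A"
  shows "\<forall>u\<in>Linf_set M. \<forall>v\<in>Linf_set M. y (fun_add u v) = y u + y v"
    and "\<forall>c. \<forall>u\<in>Linf_set M. y (fun_scal c u) = c * y u"
    and "\<forall>h\<in>Linf_set M. \<bar>y h\<bar> \<le> Linf_norm M h"
    and "\<And>h c. h \<in> Linf_set M \<Longrightarrow> (\<And>x. x \<in> A \<Longrightarrow> c \<le> Y (h x)) \<Longrightarrow> c \<le> y h"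
proof -
  have "0 < measure M A"
    using A(2,3) emeasure_eq_ennreal_measure[of M A] by (auto simp: less_top)
  have int_const: "integrable M (\<lambda>x. indicator A x * c)" for c :: real
    using A by (simp add: less_top)
  have "A \<inter> space M = A" using sets.sets_into_space[OF A(1)] by blast
  then have integral_const: "(\<integral>x. indicator A x * c \<partial>M) = measure M A * c" for c :: real
    by simp
  have int: "integrable M (\<lambda>x. indicator A x * Y (h x))" if h: "h \<in> Linf_set M" for h :: "'a \<Rightarrow> 'b"
  proof (rule Bochner_Integration.integrable_bound[OF int_const[of "Linf_norm M h"]])
    have "(\<lambda>x. Y (h x)) \<in> borel_measurable M"
      using h by (intro borel_measurable_continuous_comp_strongly_measurable[OF cm _ dual_unit_ball_continuous[OF Y]])
        (simp add: Linf_set_def)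
    then show "(\<lambda>x. indicator A x * Y (h x)) \<in> borel_measurable M" using A(1) by measurable
    show "AE x in M. norm (indicator A x * Y (h x)) \<le> norm (indicator A x * Linf_norm M h)"
      using AE_norm_le_Linf_norm[OF h] by eventually_elim
        (use Linf_norm_nonneg[OF h] in \<open>auto simp: indicator_def intro: order_trans[OF dual_unit_ballD(3)[OF Y]]\<close>)
  qed
  show "\<forall>u\<in>Linf_set M. \<forall>v\<in>Linf_set M. y (fun_add u v) = y u + y v"
    using int by (simp add: y_def fun_add_def dual_unit_ballD(1)[OF Y] distrib_left add_divide_distrib)
  show "\<forall>c. \<forall>u\<in>Linf_set M. y (fun_scal c u) = c * y u"
    by (simp add: y_def fun_scal_def dual_unit_ballD(2)[OF Y] mult.left_commute)
  show "\<forall>h\<in>Linf_set M. \<bar>y h\<bar> \<le> Linf_norm M h"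
  proof
    fix h :: "'a \<Rightarrow> 'b" assume h: "h \<in> Linf_set M"
    have "\<bar>\<integral>x. indicator A x * Y (h x) \<partial>M\<bar> \<le> (\<integral>x. \<bar>indicator A x * Y (h x)\<bar> \<partial>M)"
      using integral_norm_bound[of M "\<lambda>x. indicator A x * Y (h x)"] by simp
    also have "\<dots> \<le> (\<integral>x. indicator A x * Linf_norm M h \<partial>M)"
      using AE_norm_le_Linf_norm[OF h] Linf_norm_nonneg[OF h] int[OF h] int_const
      by (intro integral_mono_AE) (auto simp: indicator_def intro: order_trans[OF dual_unit_ballD(3)[OF Y]])
    finally show "\<bar>y h\<bar> \<le> Linf_norm M h"
      using \<open>0 < measure M A\<close> by (simp add: y_def integral_const pos_divide_le_eq mult.commute
          \<open>A \<inter> space M = A\<close>)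
  qed
  show "c \<le> y h" if h: "h \<in> Linf_set M" and c: "\<And>x. x \<in> A \<Longrightarrow> c \<le> Y (h x)" for h c
  proof -
    have "measure M A * c \<le> (\<integral>x. indicator A x * Y (h x) \<partial>M)"
      unfolding integral_const[symmetric] using int[OF h] int_const c
      by (intro integral_mono) (auto simp: indicator_def)
    then show ?thesis using \<open>0 < measure M A\<close> by (simp add: y_def pos_le_divide_eq mult.commute)
  qed
qed

text \<open>On a set A of positive measure where f1 is nearly constant with norm almost one and f2 is
  nearly constant, apply (**) in X to the two constants and average over A.\<close>
lemma Linf_star_star_witness:
  fixes f1 f2 :: "'a \<Rightarrow> 'b::banach"
  assumes cm: "complete_measure M" and sf: "sigma_finite_measure M"
    and H: "banach_property_star_star TYPE('b)"
    and f1: "f1 \<in> Linf_set M" "Linf_norm M f1 = 1" and f2: "f2 \<in> Linf_set M" "Linf_norm M f2 = 1"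
    and \<epsilon>: "0 < \<epsilon>" "\<epsilon> < 1"
  obtains y h1 h2 where
    "\<forall>u\<in>Linf_set M. \<forall>v\<in>Linf_set M. y (fun_add u v) = y u + y v"
    "\<forall>c. \<forall>u\<in>Linf_set M. y (fun_scal c u) = c * y u"
    "\<forall>z\<in>Linf_set M. \<bar>y z\<bar> \<le> Linf_norm M z" "1 - \<epsilon> < y f1"
    "h1 \<in> Linf_set M" "h2 \<in> Linf_set M" "Linf_norm M h1 \<le> 1" "Linf_norm M h2 \<le> 1"
    "1 - \<epsilon> < y h1" "1 - \<epsilon> < y h2"
    "Linf_norm M (fun_add f2 (fun_scal (-1) h1)) + Linf_norm M (fun_add f2 h2) < 2 + \<epsilon>"
proof -
  define \<delta> where "\<delta> = \<epsilon> / 6"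
  have \<delta>: "0 < \<delta>" "\<delta> < 1 / 6" using \<epsilon> by (auto simp: \<delta>_def)
  obtain A a b where A: "A \<in> sets M" "0 < emeasure M A" "emeasure M A < \<infinity>"
    and ab: "1 - 2 * \<delta> < norm a" "norm b \<le> 1"
    and near: "\<And>x. x \<in> A \<Longrightarrow> norm (f1 x - a) < \<delta>" "\<And>x. x \<in> A \<Longrightarrow> norm (f2 x - b) < 2 * \<delta>"
    by (rule Linf_norm_one_localize[OF cm sf f1 f2 \<delta>(1)]) (use \<delta> in auto)
  have "a \<noteq> 0" using ab(1) \<delta> by auto
  then have "(UNIV :: 'b set) \<noteq> {0}" by blast
  then obtain Y z w where Y: "Y \<in> dual_unit_ball" "(1 - \<delta>) * norm a \<le> Y a" "norm z \<le> 1" "norm w \<le> 1"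
    "1 - \<delta> < Y z" "1 - \<delta> < Y w" "norm (b - z) + norm (b + w) \<le> 2 + \<delta>"
    by (rule star_star_ball_witness[OF H _ \<delta>(1) ab(2)])
  define y where "y h = (\<integral>x. indicator A x * Y (h x) \<partial>M) / measure M A" for h :: "'a \<Rightarrow> 'b"
  note y = Linf_average_functional[OF cm A Y(1), folded y_def]
  define h1 where "h1 x = (if x \<in> A then z else f2 x)" for x
  define h2 where "h2 x = (if x \<in> A then w else (-1) *\<^sub>R f2 x)" for x
  have ae2: "AE x in M. norm (f2 x) \<le> 1" using AE_norm_le_Linf_norm[OF f2(1)] f2(2) by simp
  have sm2: "strongly_measurable M f2" using f2(1) by (simp add: Linf_set_def)
  have h: "h1 \<in> Linf_set M" "h2 \<in> Linf_set M" "Linf_norm M h1 \<le> 1" "Linf_norm M h2 \<le> 1"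
    using Linf_set_patch[OF sm2 ae2 A(1) Y(3)]
      Linf_set_patch[OF strongly_measurable_scaleR[OF sm2] _ A(1) Y(4), of "-1"] ae2
    by (simp_all add: h1_def[abs_def] h2_def[abs_def])
  have "(1 - \<delta>) * (1 - 2 * \<delta>) - \<delta> \<le> Y (f1 x)" if "x \<in> A" for x
  proof -
    have "(1 - \<delta>) * (1 - 2 * \<delta>) \<le> (1 - \<delta>) * norm a"
      using ab(1) \<delta> by (intro mult_left_mono) auto
    then show ?thesis using Y(2) dual_unit_ball_ge[OF Y(1), of a "f1 x"] near(1)[OF that] by linarith
  qed
  then have "(1 - \<delta>) * (1 - 2 * \<delta>) - \<delta> \<le> y f1" by (rule y(4)[OF f1(1)])
  moreover have "(1 - \<delta>) * (1 - 2 * \<delta>) - \<delta> = 1 - 4 * \<delta> + 2 * (\<delta> * \<delta>)" by (simp add: algebra_simps)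
  moreover have "0 \<le> \<delta> * \<delta>" "\<epsilon> = 6 * \<delta>" by (simp_all add: \<delta>_def)
  ultimately have "1 - \<epsilon> < y f1" using \<delta>(1) by linarith
  have "Y z \<le> y h1" "Y w \<le> y h2"
    by (rule y(4)[OF h(1)], simp add: h1_def) (rule y(4)[OF h(2)], simp add: h2_def)
  then have "1 - \<epsilon> < y h1" "1 - \<epsilon> < y h2"
    using Y(5,6) \<delta> by (auto simp: \<delta>_def)
  have "Linf_norm M (fun_add f2 (fun_scal (-1) h1)) \<le> 2 * \<delta> + norm (b - z)"
  proof (rule Linf_norm_le)
    have "norm (f2 x - z) \<le> 2 * \<delta> + norm (b - z)" if "x \<in> A" for x
      using near(2)[OF that] norm_triangle_ineq[of "f2 x - b" "b - z"] by simp
    then show "AE x in M. norm (fun_add f2 (fun_scal (-1) h1) x) \<le> 2 * \<delta> + norm (b - z)"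
      using \<delta> by (auto simp: fun_add_def fun_scal_def h1_def)
  qed (use \<delta> in simp)
  moreover have "Linf_norm M (fun_add f2 h2) \<le> 2 * \<delta> + norm (b + w)"
  proof (rule Linf_norm_le)
    have "norm (f2 x + w) \<le> 2 * \<delta> + norm (b + w)" if "x \<in> A" for x
      using near(2)[OF that] norm_triangle_ineq[of "f2 x - b" "b + w"] by simp
    then show "AE x in M. norm (fun_add f2 h2 x) \<le> 2 * \<delta> + norm (b + w)"
      using \<delta> by (auto simp: fun_add_def h2_def)
  qed (use \<delta> in simp)
  ultimately have "Linf_norm M (fun_add f2 (fun_scal (-1) h1)) + Linf_norm M (fun_add f2 h2) < 2 + \<epsilon>"
    using Y(7) \<delta> by (simp add: \<delta>_def)
  then show thesis
    using that y(1-3) h \<open>1 - \<epsilon> < y f1\<close> \<open>1 - \<epsilon> < y h1\<close> \<open>1 - \<epsilon> < y h2\<close> by blast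
qed

lemma Linf_property_star_star:
  fixes M :: "'a measure"
  assumes "complete_measure M" "sigma_finite_measure M" "banach_property_star_star TYPE('b::banach)"
  shows "property_star_star (Linf_set M :: ('a \<Rightarrow> 'b) set) fun_add fun_scal (Linf_norm M)"
proof (rule property_star_starI)
  show "\<forall>u\<in>Linf_set M. \<forall>v\<in>Linf_set M. fun_add u v \<in> (Linf_set M :: ('a \<Rightarrow> 'b) set)"
    using Linf_fun_add by blast
  show "\<forall>u\<in>Linf_set M. fun_scal (-1) u \<in> (Linf_set M :: ('a \<Rightarrow> 'b) set)"
    using Linf_fun_scal by blast
  show "\<forall>u::'a \<Rightarrow> 'b. fun_scal (-1) (fun_scal (-1) u) = u" by (simp add: fun_scal_def)
  show "\<forall>u\<in>Linf_set M. 0 \<le> Linf_norm M u" using Linf_norm_nonneg by blast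
qed (rule Linf_star_star_witness[OF assms], assumption+, intro exI conjI, assumption+)

theorem theorem4p8:
  fixes M :: "'a measure"
  assumes "complete_measure M"
    and "sigma_finite_measure M"
    and "banach_property_star_star TYPE('b::banach)"
  shows "property_star_star (L1_set M :: ('a \<Rightarrow> 'b) set) fun_add fun_scal (L1_norm M) \<and>
         property_star_star (Linf_set M :: ('a \<Rightarrow> 'b) set) fun_add fun_scal (Linf_norm M)"
  using L1_property_star_star[OF assms(1,3)] Linf_property_star_star[OF assms] by blast

end
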